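(* Let $a,r\in(0,\infty)$ and $b,c\in[1,\infty)$. Let $f,g:(0,\infty)\to[0,\infty)$ be measurable functions such that $f$ is $b$-almost monotone and $g$ is $c$-almost monotone. If $(f,g)$ is positively $(b,c)$-monotone, then $$\int_0^rf(t)g(t)t^{a-1}\,dt\ge ar^{-a}\frac{b^{-1}+c^{-1}}{1+bc}\Big(\int_0^rf(t)t^{a-1}\,dt\Big)\Big(\int_0^rg(t)t^{a-1}\,dt\Big),$$ $$\int_r^\infty f(t)g(t)t^{-a-1}\,dt\ge ar^a\frac{b^{-1}+c^{-1}}{1+bc}\Big(\int_r^\infty f(t)t^{-a-1}\,dt\Big)\Big(\int_r^\infty g(t)t^{-a-1}\,dt\Big).$$ If $(f,g)$ is negatively $(b,c)$-monotone, then $$\int_0^rf(t)g(t)t^{a-1}\,dt\le ar^{-a}\frac{b+c}{1+b^{-1}c^{-1}}\Big(\int_0^rf(t)t^{a-1}\,dt\Big)\Big(\int_0^rg(t)t^{a-1}\,dt\Big),$$ $$\int_r^\infty f(t)g(t)t^{-a-1}\,dt\le ar^a\frac{b+c}{1+b^{-1}c^{-1}}\Big(\int_r^\infty f(t)t^{-a-1}\,dt\Big)\Big(\int_r^\infty g(t)t^{-a-1}\,dt\Big).$$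
   Context: $f:(0,\infty)\to[0,\infty)$ is $b$-almost increasing if $x\le y$ implies $f(x)\le bf(y)$; $b$-almost decreasing if $x\le y$ implies $f(y)\le bf(x)$; $b$-almost monotone means one of the two. $(f,g)$ is positively $(b,c)$-monotone if $f$ is $b$-almost increasing and $g$ is $c$-almost increasing, or $f$ is $b$-almost decreasing and $g$ is $c$-almost decreasing; negatively $(b,c)$-monotone if $f$ is $b$-almost increasing and $g$ is $c$-almost decreasing, or vice versa. Integrals take values in $[0,\infty]$. *)

theory Defs
  imports "HOL-Analysis.Analysis"
begin

text \<open>
  Functions $(0,\infty) \to [0,\infty)$ are represented by total functions on the reals, of which
  only the values at positive arguments matter. The notions below therefore
  quantify over positive arguments only.
\<close>

definition almost_increasing :: "real \<Rightarrow> (real \<Rightarrow> real) \<Rightarrow> bool" where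
  "almost_increasing b f \<longleftrightarrow> (\<forall>x>0. \<forall>y>0. x \<le> y \<longrightarrow> f x \<le> b * f y)"

definition almost_decreasing :: "real \<Rightarrow> (real \<Rightarrow> real) \<Rightarrow> bool" where
  "almost_decreasing b f \<longleftrightarrow> (\<forall>x>0. \<forall>y>0. x \<le> y \<longrightarrow> f y \<le> b * f x)"

definition almost_monotone :: "real \<Rightarrow> (real \<Rightarrow> real) \<Rightarrow> bool" where
  "almost_monotone b f \<longleftrightarrow> almost_increasing b f \<or> almost_decreasing b f"

definition positively_monotone ::
  "real \<Rightarrow> real \<Rightarrow> (real \<Rightarrow> real) \<Rightarrow> (real \<Rightarrow> real) \<Rightarrow> bool" where
  "positively_monotone b c f g \<longleftrightarrow>
     almost_increasing b f \<and> almost_increasing c g \<or>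
     almost_decreasing b f \<and> almost_decreasing c g"

definition negatively_monotone ::
  "real \<Rightarrow> real \<Rightarrow> (real \<Rightarrow> real) \<Rightarrow> (real \<Rightarrow> real) \<Rightarrow> bool" where
  "negatively_monotone b c f g \<longleftrightarrow>
     almost_increasing b f \<and> almost_decreasing c g \<or>
     almost_decreasing b f \<and> almost_increasing c g"

end

theory Submission
  imports Defs
begin

text \<open>
  This is Chebyshev's integral inequality with a constant that absorbs the failure of exact
  monotonicity. Put \<open>u = f x\<close>, \<open>U = f y\<close>, \<open>v = g x\<close>, \<open>V = g y\<close>. For exactly monotone functions
  Chebyshev's inequality comes from integrating \<open>(U - u) * (V - v) \<ge> 0\<close>, that is
  \<open>u * v + U * V \<ge> u * V + U * v\<close>, over all pairs \<open>(x, y)\<close>. If \<open>f\<close> and \<open>g\<close> are only almost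
  monotone, one merely knows \<open>u \<le> b * U\<close> together with \<open>v \<le> c * V\<close> (positive case) or
  \<open>V \<le> c * v\<close> (negative case), up to exchanging \<open>x\<close> and \<open>y\<close>. The difference of \<open>u * v + U * V\<close> and
  \<open>K * (u * V + U * v)\<close> is affine in each variable, so it is nonnegative on the box
  \<open>0 \<le> u \<le> b * U\<close>, \<open>0 \<le> v \<le> c * V\<close> as soon as it is so at the four corners. This allows every
  \<open>0 \<le> K \<le> min (1/b) (1/c)\<close> in the lower bound (\<open>cross_sum_le\<close>). In the same way the upper bound of
  the negative case holds with every constant \<open>L \<ge> max b c\<close> (\<open>cross_sum_ge\<close>). The constants of the
  theorem lie in these ranges.

  The integration over pairs is done with respect to the weighted measure \<open>t\<^sup>p dt\<close>. Its total
  mass is \<open>r\<^sup>a / a\<close> on \<open>(0, r)\<close> with \<open>p = a - 1\<close>, and \<open>r\<^sup>-\<^sup>a / a\<close> on \<open>(r, \<infinity>)\<close> with \<open>p = - a - 1\<close>.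
  The reciprocal of the mass is the factor in front of the constant.
\<close>

section \<open>Chebyshev's inequality for a pair of points\<close>

text \<open>
  The difference of the two sides is affine in \<open>u\<close>. The identity in the proof interpolates it
  between \<open>u = 0\<close>, where it is \<open>U * (V - K * v)\<close>, and \<open>u = b * U\<close>, where it is
  \<open>U * (V * (1 - K * b) + v * (b - K))\<close>; both brackets are nonnegative.
\<close>

lemma cross_sum_le:
  fixes b c K u U v V :: real
  assumes "b \<ge> 1" and "0 \<le> K" and "K * b \<le> 1" and "K * c \<le> 1"
    and "0 \<le> u" and "u \<le> b * U" and "0 \<le> v" and "v \<le> c * V" and "0 \<le> V"
  shows "K * (u * V + U * v) \<le> u * v + U * V"
proof -
  have "K * v \<le> (K * c) * V"
    using mult_left_mono[OF \<open>v \<le> c * V\<close> \<open>0 \<le> K\<close>] by (simp add: mult.assoc)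
  also have "\<dots> \<le> V"
    using mult_right_mono[OF \<open>K * c \<le> 1\<close> \<open>0 \<le> V\<close>] by simp
  finally have at_0: "0 \<le> V - K * v" by simp
  have "K \<le> K * b"
    using mult_left_mono[OF \<open>b \<ge> 1\<close> \<open>0 \<le> K\<close>] by simp
  then have "K \<le> b"
    using assms by linarith
  then have at_bU: "0 \<le> V * (1 - K * b) + v * (b - K)"
    using assms by simp
  have "0 \<le> (b * U - u) * (V - K * v) + u * (V * (1 - K * b) + v * (b - K))"
    using at_0 at_bU assms by simp
  also have "\<dots> = b * (u * v + U * V - K * (u * V + U * v))"
    by (simp add: algebra_simps)
  finally show ?thesis
    using \<open>b \<ge> 1\<close> by (simp add: zero_le_mult_iff)
qed

text \<open>
  The counterpart for opposite monotonicity, by the same interpolation in \<open>u\<close>.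
\<close>

lemma cross_sum_ge:
  fixes b c L u U v V :: real
  assumes "b \<ge> 1" and "b \<le> L" and "c \<le> L"
    and "0 \<le> u" and "u \<le> b * U" and "0 \<le> v" and "V \<le> c * v" and "0 \<le> V"
  shows "u * v + U * V \<le> L * (u * V + U * v)"
proof -
  have "V \<le> L * v"
    using mult_right_mono[OF \<open>c \<le> L\<close> \<open>0 \<le> v\<close>] assms by simp
  then have at_0: "0 \<le> L * v - V" by simp
  have "1 * 1 \<le> b * L"
    using assms by (intro mult_mono) auto
  then have at_bU: "0 \<le> v * (L - b) + V * (b * L - 1)"
    using assms by simp
  have "0 \<le> (b * U - u) * (L * v - V) + u * (v * (L - b) + V * (b * L - 1))"
    using at_0 at_bU assms by simp
  also have "\<dots> = b * (L * (u * V + U * v) - (u * v + U * V))"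
    by (simp add: algebra_simps)
  finally show ?thesis
    using \<open>b \<ge> 1\<close> by (simp add: zero_le_mult_iff)
qed

text \<open>
  Both sides are unchanged when \<open>x\<close> and \<open>y\<close> are exchanged, which is why the order of the two
  points and the direction of the monotonicity do not matter.
\<close>

lemma positively_monotone_cross_sum_le:
  assumes "positively_monotone b c f g"
    and "b \<ge> 1" and "0 \<le> K" and "K * b \<le> 1" and "K * c \<le> 1"
    and f: "\<And>t. t > 0 \<Longrightarrow> f t \<ge> 0" and g: "\<And>t. t > 0 \<Longrightarrow> g t \<ge> 0"
    and "x > 0" and "y > 0"
  shows "K * (f x * g y + f y * g x) \<le> f x * g x + f y * g y"
proof -
  have "f x \<le> b * f y \<and> g x \<le> c * g y \<or> f y \<le> b * f x \<and> g y \<le> c * g x"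
    using assms(1) \<open>x > 0\<close> \<open>y > 0\<close> linear[of x y]
    unfolding positively_monotone_def almost_increasing_def almost_decreasing_def by blast
  then show ?thesis
    using cross_sum_le[OF assms(2-5), of "f x" "f y" "g x" "g y"]
      cross_sum_le[OF assms(2-5), of "f y" "f x" "g y" "g x"] f g \<open>x > 0\<close> \<open>y > 0\<close>
    by (auto simp: add.commute)
qed

lemma negatively_monotone_cross_sum_ge:
  assumes "negatively_monotone b c f g"
    and "b \<ge> 1" and "b \<le> L" and "c \<le> L"
    and f: "\<And>t. t > 0 \<Longrightarrow> f t \<ge> 0" and g: "\<And>t. t > 0 \<Longrightarrow> g t \<ge> 0"
    and "x > 0" and "y > 0"
  shows "f x * g x + f y * g y \<le> L * (f x * g y + f y * g x)"
proof -
  have "f x \<le> b * f y \<and> g y \<le> c * g x \<or> f y \<le> b * f x \<and> g x \<le> c * g y"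
    using assms(1) \<open>x > 0\<close> \<open>y > 0\<close> linear[of x y]
    unfolding negatively_monotone_def almost_increasing_def almost_decreasing_def by blast
  then show ?thesis
    using cross_sum_ge[OF assms(2-4), of "f x" "f y" "g x" "g y"]
      cross_sum_ge[OF assms(2-4), of "f y" "f x" "g y" "g x"] f g \<open>x > 0\<close> \<open>y > 0\<close>
    by (auto simp: add.commute)
qed

section \<open>Integration over pairs of points\<close>

text \<open>
  Each summand is a product of a function of \<open>x\<close> and a function of \<open>y\<close>, so the iterated integrals
  split by linearity, over an arbitrary measure and without Fubini's theorem.
\<close>

lemma nn_integral_diagonal_sum:
  fixes f g :: "'a \<Rightarrow> ennreal"
  assumes [measurable]: "f \<in> borel_measurable M" "g \<in> borel_measurable M"
  shows "(\<integral>\<^sup>+y. \<integral>\<^sup>+x. f x * g x + f y * g y \<partial>M \<partial>M)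
    = 2 * (emeasure M (space M) * (\<integral>\<^sup>+x. f x * g x \<partial>M))"
proof -
  have "(\<integral>\<^sup>+y. \<integral>\<^sup>+x. f x * g x + f y * g y \<partial>M \<partial>M)
      = (\<integral>\<^sup>+y. (\<integral>\<^sup>+x. f x * g x \<partial>M) + f y * g y * emeasure M (space M) \<partial>M)"
    by (simp add: nn_integral_add)
  also have "\<dots> = 2 * (emeasure M (space M) * (\<integral>\<^sup>+x. f x * g x \<partial>M))"
    by (simp add: nn_integral_add nn_integral_cmult nn_integral_multc mult.commute mult_2)
  finally show ?thesis .
qed

lemma nn_integral_cross_sum:
  fixes f g :: "'a \<Rightarrow> ennreal"
  assumes [measurable]: "f \<in> borel_measurable M" "g \<in> borel_measurable M"
  shows "(\<integral>\<^sup>+y. \<integral>\<^sup>+x. f x * g y + f y * g x \<partial>M \<partial>M)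
    = 2 * ((\<integral>\<^sup>+x. f x \<partial>M) * (\<integral>\<^sup>+x. g x \<partial>M))"
  by (simp add: nn_integral_add nn_integral_cmult nn_integral_multc mult_2)

lemma ennreal_two_mult_le_cancel:
  fixes x y :: ennreal
  assumes "2 * x \<le> 2 * y"
  shows "x \<le> y"
  using assms by (simp add: ennreal_mult_le_mult_iff)

lemma chebyshev_nn_integral_ge:
  fixes f g :: "'a \<Rightarrow> ennreal"
  assumes [measurable]: "f \<in> borel_measurable M" "g \<in> borel_measurable M"
    and "\<And>x y. x \<in> space M \<Longrightarrow> y \<in> space M \<Longrightarrow>
      K * (f x * g y + f y * g x) \<le> f x * g x + f y * g y"
  shows "K * ((\<integral>\<^sup>+x. f x \<partial>M) * (\<integral>\<^sup>+x. g x \<partial>M))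
    \<le> emeasure M (space M) * (\<integral>\<^sup>+x. f x * g x \<partial>M)"
proof (rule ennreal_two_mult_le_cancel)
  have "2 * (K * ((\<integral>\<^sup>+x. f x \<partial>M) * (\<integral>\<^sup>+x. g x \<partial>M)))
      = K * (\<integral>\<^sup>+y. \<integral>\<^sup>+x. f x * g y + f y * g x \<partial>M \<partial>M)"
    by (simp add: nn_integral_cross_sum mult.left_commute)
  also have "\<dots> = (\<integral>\<^sup>+y. \<integral>\<^sup>+x. K * (f x * g y + f y * g x) \<partial>M \<partial>M)"
    by (simp add: nn_integral_add nn_integral_cmult nn_integral_multc)
  also have "\<dots> \<le> (\<integral>\<^sup>+y. \<integral>\<^sup>+x. f x * g x + f y * g y \<partial>M \<partial>M)"
    by (intro nn_integral_mono assms)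
  also have "\<dots> = 2 * (emeasure M (space M) * (\<integral>\<^sup>+x. f x * g x \<partial>M))"
    by (simp add: nn_integral_diagonal_sum)
  finally show "2 * (K * ((\<integral>\<^sup>+x. f x \<partial>M) * (\<integral>\<^sup>+x. g x \<partial>M)))
    \<le> 2 * (emeasure M (space M) * (\<integral>\<^sup>+x. f x * g x \<partial>M))" .
qed

lemma chebyshev_nn_integral_le:
  fixes f g :: "'a \<Rightarrow> ennreal"
  assumes [measurable]: "f \<in> borel_measurable M" "g \<in> borel_measurable M"
    and "\<And>x y. x \<in> space M \<Longrightarrow> y \<in> space M \<Longrightarrow>
      f x * g x + f y * g y \<le> L * (f x * g y + f y * g x)"
  shows "emeasure M (space M) * (\<integral>\<^sup>+x. f x * g x \<partial>M)
    \<le> L * ((\<integral>\<^sup>+x. f x \<partial>M) * (\<integral>\<^sup>+x. g x \<partial>M))"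
proof (rule ennreal_two_mult_le_cancel)
  have "2 * (emeasure M (space M) * (\<integral>\<^sup>+x. f x * g x \<partial>M))
      = (\<integral>\<^sup>+y. \<integral>\<^sup>+x. f x * g x + f y * g y \<partial>M \<partial>M)"
    by (simp add: nn_integral_diagonal_sum)
  also have "\<dots> \<le> (\<integral>\<^sup>+y. \<integral>\<^sup>+x. L * (f x * g y + f y * g x) \<partial>M \<partial>M)"
    by (intro nn_integral_mono assms)
  also have "\<dots> = L * (\<integral>\<^sup>+y. \<integral>\<^sup>+x. f x * g y + f y * g x \<partial>M \<partial>M)"
    by (simp add: nn_integral_add nn_integral_cmult nn_integral_multc)
  also have "\<dots> = 2 * (L * ((\<integral>\<^sup>+x. f x \<partial>M) * (\<integral>\<^sup>+x. g x \<partial>M)))"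
    by (simp add: nn_integral_cross_sum mult.left_commute)
  finally show "2 * (emeasure M (space M) * (\<integral>\<^sup>+x. f x * g x \<partial>M))
    \<le> 2 * (L * ((\<integral>\<^sup>+x. f x \<partial>M) * (\<integral>\<^sup>+x. g x \<partial>M)))" .
qed

section \<open>Weighted Lebesgue measure on a set of positive reals\<close>

abbreviation weighted_on :: "real set \<Rightarrow> (real \<Rightarrow> real) \<Rightarrow> real measure" where
  "weighted_on S w \<equiv> density (lebesgue_on S) (\<lambda>t. ennreal (w t))"

lemma nn_integral_weighted_on:
  assumes [measurable]: "S \<in> sets lebesgue" "w \<in> borel_measurable (lebesgue_on S)"
      "h \<in> borel_measurable (lebesgue_on S)"
    and "\<And>t. t \<in> S \<Longrightarrow> 0 \<le> h t" and "\<And>t. t \<in> S \<Longrightarrow> 0 \<le> w t"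
  shows "(\<integral>\<^sup>+t. ennreal (h t) \<partial>weighted_on S w)
    = (\<integral>\<^sup>+t\<in>S. ennreal (h t * w t) \<partial>lebesgue)"
proof -
  have "(\<integral>\<^sup>+t. ennreal (h t) \<partial>weighted_on S w)
      = (\<integral>\<^sup>+t. ennreal (w t) * ennreal (h t) \<partial>lebesgue_on S)"
    by (intro nn_integral_density) measurable
  also have "\<dots> = (\<integral>\<^sup>+t\<in>S. ennreal (w t) * ennreal (h t) \<partial>lebesgue)"
    by (intro nn_integral_restrict_space) auto
  also have "\<dots> = (\<integral>\<^sup>+t\<in>S. ennreal (h t * w t) \<partial>lebesgue)"
    using assms(4,5)
    by (intro nn_integral_cong) (auto simp: indicator_def ennreal_mult mult.commute)
  finally show ?thesis .
qed

text \<open>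
  The common form of the bounds on \<open>(0, r)\<close> and on \<open>(r, \<infinity>)\<close>: only the total mass \<open>W\<close> of the
  weight on \<open>S\<close> enters.
\<close>

lemma weighted_chebyshev_ge:
  fixes f g w :: "real \<Rightarrow> real"
  assumes pos: "positively_monotone b c f g"
    and K: "b \<ge> 1" "0 \<le> K" "K * b \<le> 1" "K * c \<le> 1"
    and f: "\<And>t. t > 0 \<Longrightarrow> f t \<ge> 0" and g: "\<And>t. t > 0 \<Longrightarrow> g t \<ge> 0"
    and S: "S \<in> sets lebesgue" "S \<subseteq> {0<..}"
    and meas: "f \<in> borel_measurable (lebesgue_on S)" "g \<in> borel_measurable (lebesgue_on S)"
      "w \<in> borel_measurable (lebesgue_on S)"
    and w: "\<And>t. t \<in> S \<Longrightarrow> w t \<ge> 0"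
    and W: "(\<integral>\<^sup>+t\<in>S. ennreal (w t) \<partial>lebesgue) = ennreal W" "W > 0"
  shows "ennreal (inverse W * K) * (\<integral>\<^sup>+t\<in>S. ennreal (f t * w t) \<partial>lebesgue)
      * (\<integral>\<^sup>+t\<in>S. ennreal (g t * w t) \<partial>lebesgue)
    \<le> (\<integral>\<^sup>+t\<in>S. ennreal (f t * g t * w t) \<partial>lebesgue)"
proof -
  let ?M = "weighted_on S w"
  note [measurable] = S(1) meas
  have nonneg: "f t \<ge> 0" "g t \<ge> 0" if "t \<in> S" for t
    using that S f g by auto
  have mass: "emeasure ?M (space ?M) = ennreal W"
    using nn_integral_weighted_on[OF S(1) meas(3), of "\<lambda>_. 1"] w W(1) by simp
  have prod: "(\<integral>\<^sup>+t. ennreal (f t) * ennreal (g t) \<partial>?M)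
      = (\<integral>\<^sup>+t\<in>S. ennreal (f t * g t * w t) \<partial>lebesgue)"
    using nn_integral_weighted_on[OF S(1) meas(3), of "\<lambda>t. f t * g t"] nonneg w
    by (subst nn_integral_cong[where v = "\<lambda>t. ennreal (f t * g t)"])
      (auto simp: ennreal_mult)
  have "ennreal K * ((\<integral>\<^sup>+t. ennreal (f t) \<partial>?M) * (\<integral>\<^sup>+t. ennreal (g t) \<partial>?M))
      \<le> emeasure ?M (space ?M) * (\<integral>\<^sup>+t. ennreal (f t) * ennreal (g t) \<partial>?M)"
  proof (rule chebyshev_nn_integral_ge)
    fix x y assume "x \<in> space ?M" and "y \<in> space ?M"
    then have "x \<in> S" and "y \<in> S"
      by auto
    then have "K * (f x * g y + f y * g x) \<le> f x * g x + f y * g y"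
      using S by (intro positively_monotone_cross_sum_le[OF pos K f g]) auto
    then show "ennreal K * (ennreal (f x) * ennreal (g y) + ennreal (f y) * ennreal (g x))
        \<le> ennreal (f x) * ennreal (g x) + ennreal (f y) * ennreal (g y)"
      using nonneg \<open>x \<in> S\<close> \<open>y \<in> S\<close> K(2)
      by (simp flip: ennreal_mult ennreal_plus)
  qed measurable
  then have "ennreal K * ((\<integral>\<^sup>+t\<in>S. ennreal (f t * w t) \<partial>lebesgue)
        * (\<integral>\<^sup>+t\<in>S. ennreal (g t * w t) \<partial>lebesgue))
      \<le> ennreal W * (\<integral>\<^sup>+t\<in>S. ennreal (f t * g t * w t) \<partial>lebesgue)"
    using nonneg w meas S(1) unfolding mass prod by (simp add: nn_integral_weighted_on)
  from mult_left_mono[OF this, of "ennreal (inverse W)"] show ?thesis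
    using W(2) K(2) by (simp add: mult.assoc[symmetric] ennreal_mult[symmetric])
qed

lemma weighted_chebyshev_le:
  fixes f g w :: "real \<Rightarrow> real"
  assumes neg: "negatively_monotone b c f g"
    and L: "b \<ge> 1" "b \<le> L" "c \<le> L"
    and f: "\<And>t. t > 0 \<Longrightarrow> f t \<ge> 0" and g: "\<And>t. t > 0 \<Longrightarrow> g t \<ge> 0"
    and S: "S \<in> sets lebesgue" "S \<subseteq> {0<..}"
    and meas: "f \<in> borel_measurable (lebesgue_on S)" "g \<in> borel_measurable (lebesgue_on S)"
      "w \<in> borel_measurable (lebesgue_on S)"
    and w: "\<And>t. t \<in> S \<Longrightarrow> w t \<ge> 0"
    and W: "(\<integral>\<^sup>+t\<in>S. ennreal (w t) \<partial>lebesgue) = ennreal W" "W > 0"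
  shows "(\<integral>\<^sup>+t\<in>S. ennreal (f t * g t * w t) \<partial>lebesgue)
    \<le> ennreal (inverse W * L) * (\<integral>\<^sup>+t\<in>S. ennreal (f t * w t) \<partial>lebesgue)
      * (\<integral>\<^sup>+t\<in>S. ennreal (g t * w t) \<partial>lebesgue)"
proof -
  let ?M = "weighted_on S w"
  note [measurable] = S(1) meas
  have nonneg: "f t \<ge> 0" "g t \<ge> 0" if "t \<in> S" for t
    using that S f g by auto
  have "L \<ge> 0"
    using L by simp
  have mass: "emeasure ?M (space ?M) = ennreal W"
    using nn_integral_weighted_on[OF S(1) meas(3), of "\<lambda>_. 1"] w W(1) by simp
  have prod: "(\<integral>\<^sup>+t. ennreal (f t) * ennreal (g t) \<partial>?M)
      = (\<integral>\<^sup>+t\<in>S. ennreal (f t * g t * w t) \<partial>lebesgue)"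
    using nn_integral_weighted_on[OF S(1) meas(3), of "\<lambda>t. f t * g t"] nonneg w
    by (subst nn_integral_cong[where v = "\<lambda>t. ennreal (f t * g t)"])
      (auto simp: ennreal_mult)
  have "emeasure ?M (space ?M) * (\<integral>\<^sup>+t. ennreal (f t) * ennreal (g t) \<partial>?M)
      \<le> ennreal L * ((\<integral>\<^sup>+t. ennreal (f t) \<partial>?M) * (\<integral>\<^sup>+t. ennreal (g t) \<partial>?M))"
  proof (rule chebyshev_nn_integral_le)
    fix x y assume "x \<in> space ?M" and "y \<in> space ?M"
    then have "x \<in> S" and "y \<in> S"
      by auto
    then have "f x * g x + f y * g y \<le> L * (f x * g y + f y * g x)"
      using S by (intro negatively_monotone_cross_sum_ge[OF neg L f g]) auto
    then show "ennreal (f x) * ennreal (g x) + ennreal (f y) * ennreal (g y)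
        \<le> ennreal L * (ennreal (f x) * ennreal (g y) + ennreal (f y) * ennreal (g x))"
      using nonneg \<open>x \<in> S\<close> \<open>y \<in> S\<close> \<open>L \<ge> 0\<close>
      by (simp flip: ennreal_mult ennreal_plus)
  qed measurable
  then have "ennreal W * (\<integral>\<^sup>+t\<in>S. ennreal (f t * g t * w t) \<partial>lebesgue)
      \<le> ennreal L * ((\<integral>\<^sup>+t\<in>S. ennreal (f t * w t) \<partial>lebesgue)
        * (\<integral>\<^sup>+t\<in>S. ennreal (g t * w t) \<partial>lebesgue))"
    using nonneg w meas S(1) unfolding mass prod by (simp add: nn_integral_weighted_on)
  from mult_left_mono[OF this, of "ennreal (inverse W)"] show ?thesis
    using W(2) \<open>L \<ge> 0\<close> by (simp add: mult.assoc[symmetric] ennreal_mult[symmetric])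
qed

section \<open>The mass of the power weights\<close>

lemma set_nn_integral_lebesgue_eq_has_integral:
  fixes h :: "real \<Rightarrow> real"
  assumes [measurable]: "S \<in> sets borel" "h \<in> borel_measurable borel"
    and "\<And>t. t \<in> S \<Longrightarrow> 0 \<le> h t" and "(h has_integral I) S"
  shows "(\<integral>\<^sup>+t\<in>S. ennreal (h t) \<partial>lebesgue) = ennreal I"
proof -
  have "(\<integral>\<^sup>+t\<in>S. ennreal (h t) \<partial>lebesgue) = (\<integral>\<^sup>+t\<in>S. ennreal (h t) \<partial>lborel)"
    by (intro nn_integral_completion) measurable
  then show ?thesis
    using nn_integral_has_integral_lebesgue'[of S h I] assms by simp
qed

lemma nn_integral_powr_from_0:
  fixes a r :: real
  assumes "a > 0" and "r > 0"
  shows "(\<integral>\<^sup>+t\<in>{0<..<r}. ennreal (t powr (a - 1)) \<partial>lebesgue) = ennreal (r powr a / a)"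
proof -
  have "((\<lambda>t. t powr (a - 1)) has_integral r powr a / a) {0..r}"
    using has_integral_powr_from_0[of "a - 1" r] assms by simp
  then have "((\<lambda>t. t powr (a - 1)) has_integral r powr a / a) {0<..<r}"
    by (simp add: has_integral_Icc_iff_Ioo)
  then show ?thesis
    by (intro set_nn_integral_lebesgue_eq_has_integral) auto
qed

lemma nn_integral_powr_to_inf:
  fixes a r :: real
  assumes "a > 0" and "r > 0"
  shows "(\<integral>\<^sup>+t\<in>{r<..}. ennreal (t powr (- a - 1)) \<partial>lebesgue) = ennreal (r powr (- a) / a)"
proof -
  have "((\<lambda>t. t powr (- a - 1)) has_integral r powr (- a) / a) {r..}"
    using has_integral_powr_to_inf[of "- a - 1" r] assms by simp
  then have "((\<lambda>t. t powr (- a - 1)) has_integral r powr (- a) / a) {r<..}"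
    by (subst has_integral_spike_set_eq[where T = "{r..}"])
      (auto intro: negligible_subset[of "{r}"])
  then show ?thesis
    by (intro set_nn_integral_lebesgue_eq_has_integral) auto
qed

section \<open>Admissibility of the constants\<close>

text \<open>
  After clearing denominators, \<open>K * b \<le> 1\<close> says \<open>b + c \<le> c + b * c\<^sup>2\<close>, which is \<open>1 \<le> c\<^sup>2\<close>; the bound
  for \<open>c\<close> follows by symmetry. Similarly \<open>b \<le> L\<close> amounts to \<open>1/c \<le> c\<close>.
\<close>

lemma positive_constant_bounds:
  fixes b c :: real
  assumes "b \<ge> 1" and "c \<ge> 1"
  defines "K \<equiv> (inverse b + inverse c) / (1 + b * c)"
  shows "0 \<le> K" and "K * b \<le> 1" and "K * c \<le> 1"
proof -
  have "1 * 1 \<le> b * b" and "1 * 1 \<le> c * c"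
    using assms(1,2) by (intro mult_mono; simp)+
  then have "c * 1 \<le> c * (b * b)" and "b * 1 \<le> b * (c * c)"
    using assms(1,2) by (intro mult_left_mono; simp)+
  moreover have "K * b = (b + c) / (c * (1 + b * c))" "K * c = (b + c) / (b * (1 + b * c))"
    using assms(1,2) by (auto simp: K_def divide_simps)
  moreover have "0 < c * (1 + b * c)" "0 < b * (1 + b * c)"
    using assms(1,2) by (simp_all add: add_pos_pos)
  ultimately show "K * b \<le> 1" and "K * c \<le> 1"
    by (simp_all add: algebra_simps)
  show "0 \<le> K"
    using assms(1,2) by (simp add: K_def)
qed

lemma negative_constant_bounds:
  fixes b c :: real
  assumes "b \<ge> 1" and "c \<ge> 1"
  defines "L \<equiv> (b + c) / (1 + inverse b * inverse c)"
  shows "b \<le> L" and "c \<le> L"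
proof -
  have "inverse b \<le> b" and "inverse c \<le> c"
    using assms(1,2) by (simp_all add: order_trans[OF inverse_le_1_iff[THEN iffD2]])
  moreover have "b * (1 + inverse b * inverse c) = b + inverse c"
    "c * (1 + inverse b * inverse c) = c + inverse b"
    using assms(1,2) by (simp_all add: field_simps)
  moreover have "0 < 1 + inverse b * inverse c"
    using assms(1,2) by (simp add: add_pos_pos)
  ultimately show "b \<le> L" and "c \<le> L"
    by (simp_all add: L_def pos_le_divide_eq)
qed

section \<open>Bounds for power weights\<close>

theorem theorem2p13:
  fixes a r b c :: real and f g :: "real \<Rightarrow> real"
  assumes "a > 0" and "r > 0" and "b \<ge> 1" and "c \<ge> 1"
    and "\<forall>t>0. f t \<ge> 0" and "\<forall>t>0. g t \<ge> 0"
    and "f \<in> borel_measurable (lebesgue_on {0<..})"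
    and "g \<in> borel_measurable (lebesgue_on {0<..})"
    and "almost_monotone b f" and "almost_monotone c g"
  shows
    "(positively_monotone b c f g \<longrightarrow>
        (\<integral>\<^sup>+t\<in>{0<..<r}. ennreal (f t * g t * t powr (a - 1)) \<partial>lebesgue)
          \<ge> ennreal (a * r powr (- a) * ((inverse b + inverse c) / (1 + b * c)))
             * (\<integral>\<^sup>+t\<in>{0<..<r}. ennreal (f t * t powr (a - 1)) \<partial>lebesgue)
             * (\<integral>\<^sup>+t\<in>{0<..<r}. ennreal (g t * t powr (a - 1)) \<partial>lebesgue)
      \<and> (\<integral>\<^sup>+t\<in>{r<..}. ennreal (f t * g t * t powr (- a - 1)) \<partial>lebesgue)
          \<ge> ennreal (a * r powr a * ((inverse b + inverse c) / (1 + b * c)))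
             * (\<integral>\<^sup>+t\<in>{r<..}. ennreal (f t * t powr (- a - 1)) \<partial>lebesgue)
             * (\<integral>\<^sup>+t\<in>{r<..}. ennreal (g t * t powr (- a - 1)) \<partial>lebesgue))
   \<and> (negatively_monotone b c f g \<longrightarrow>
        (\<integral>\<^sup>+t\<in>{0<..<r}. ennreal (f t * g t * t powr (a - 1)) \<partial>lebesgue)
          \<le> ennreal (a * r powr (- a) * ((b + c) / (1 + inverse b * inverse c)))
             * (\<integral>\<^sup>+t\<in>{0<..<r}. ennreal (f t * t powr (a - 1)) \<partial>lebesgue)
             * (\<integral>\<^sup>+t\<in>{0<..<r}. ennreal (g t * t powr (a - 1)) \<partial>lebesgue)
      \<and> (\<integral>\<^sup>+t\<in>{r<..}. ennreal (f t * g t * t powr (- a - 1)) \<partial>lebesgue)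
          \<le> ennreal (a * r powr a * ((b + c) / (1 + inverse b * inverse c)))
             * (\<integral>\<^sup>+t\<in>{r<..}. ennreal (f t * t powr (- a - 1)) \<partial>lebesgue)
             * (\<integral>\<^sup>+t\<in>{r<..}. ennreal (g t * t powr (- a - 1)) \<partial>lebesgue))"
proof -
  let ?K = "(inverse b + inverse c) / (1 + b * c)"
  let ?L = "(b + c) / (1 + inverse b * inverse c)"
  have f: "f t \<ge> 0" and g: "g t \<ge> 0" if "t > 0" for t
    using assms(5,6) that by auto
  have K: "0 \<le> ?K" "?K * b \<le> 1" "?K * c \<le> 1"
    using positive_constant_bounds[OF assms(3,4)] by auto
  have L: "b \<le> ?L" "c \<le> ?L"
    using negative_constant_bounds[OF assms(3,4)] by auto
  have meas: "h \<in> borel_measurable (lebesgue_on S)"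
    if "h \<in> borel_measurable (lebesgue_on {0<..})" "S \<subseteq> {0<..}" for h :: "real \<Rightarrow> real" and S
    using measurable_restrict_mono[OF that] .
  have powr_meas: "(\<lambda>t. t powr p) \<in> borel_measurable (lebesgue_on S)" for p and S :: "real set"
    by (intro measurable_restrict_space1 measurable_completion) measurable
  have near: "{0<..<r} \<in> sets lebesgue" "{0<..<r} \<subseteq> {0<..}"
    by auto
  have far: "{r<..} \<in> sets lebesgue" "{r<..} \<subseteq> {0<..}"
    using assms(2) by auto
  have near_mass: "inverse (r powr a / a) = a * r powr (- a)" "r powr a / a > 0"
    and far_mass: "inverse (r powr (- a) / a) = a * r powr a" "r powr (- a) / a > 0"
    using assms(1,2) by (simp_all add: powr_minus field_simps)
  note near_facts = f g near meas[OF assms(7) near(2)] meas[OF assms(8) near(2)] powr_meas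
    powr_ge_zero nn_integral_powr_from_0[OF assms(1,2)] near_mass(2)
  note far_facts = f g far meas[OF assms(7) far(2)] meas[OF assms(8) far(2)] powr_meas
    powr_ge_zero nn_integral_powr_to_inf[OF assms(1,2)] far_mass(2)
  show ?thesis
    using weighted_chebyshev_ge[OF _ assms(3) K near_facts]
      weighted_chebyshev_ge[OF _ assms(3) K far_facts]
      weighted_chebyshev_le[OF _ assms(3) L near_facts]
      weighted_chebyshev_le[OF _ assms(3) L far_facts]
    unfolding near_mass(1) far_mass(1) by blast
qed

end
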